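(* Let $n$ be a positive integer. For $k\in\{1,\ldots,n-1\}$ let $s_k$ be the ring endomorphism of $R_n=\mathbb{Z}[x_1,\ldots,x_n,q_{ij}\mid 1\le i<j\le n]$ that swaps $x_k$ and $x_{k+1}$, fixes $x_i$ for $i\neq k,k+1$, and satisfies, for $1\le i<j\le n$, $$s_k(q_{ij})=\begin{cases}q_{ij}-q_{i\,j-1}(x_{j-1}-x_j)&\text{if }k=j-1;\\ q_{ij}+q_{i+1\,j}(x_i-x_{i+1})&\text{if }k=i;\\ q_{ij}&\text{otherwise.}\end{cases}$$ Then for all $1\le i<j\le n$ and all admissible $k,\ell\in\{1,\ldots,n-1\}$: (i) $s_k^2(q_{ij})=q_{ij}$; (ii) $s_ks_\ell(q_{ij})=s_\ell s_k(q_{ij})$ if $|k-\ell|>1$; (iii) $s_ks_{k+1}s_k(q_{ij})=s_{k+1}s_ks_{k+1}(q_{ij})$ (for $k+1\le n-1$).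
   Context: Convention: $q_{ij}=0$ unless $1\le i<j\le n$. In particular, when $j=i+1$ and $k=i=j-1$ both of the first two cases give $s_k(q_{i\,i+1})=q_{i\,i+1}$. Products such as $s_ks_\ell$ denote composition of maps. (These identities are what make the $s_k$ generate an action of the symmetric group $S_n$ on $R_n$.) *)

theory Defs
  imports "HOL-Library.Poly_Mapping" "HOL-Algebra.Ring"
begin

text \<open>
  Polynomials are finitely supported maps from monomials to integer coefficients, and monomials
  are finitely supported maps from indeterminates to exponents; the product is the convolution
  product of \<^theory>\<open>HOL-Library.Poly_Mapping\<close>. The ring \<open>R n\<close> is the set of those
  polynomials in which only the indeterminates of \<open>gens n\<close> occur.
\<close>

datatype var = X nat | Q nat nat

type_synonym zpoly = "(var \<Rightarrow>\<^sub>0 nat) \<Rightarrow>\<^sub>0 int"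

definition gens :: "nat \<Rightarrow> var set" where
  "gens n = {X i | i. 1 \<le> i \<and> i \<le> n} \<union> {Q i j | i j. 1 \<le> i \<and> i < j \<and> j \<le> n}"

definition R :: "nat \<Rightarrow> zpoly ring" where
  "R n = \<lparr>carrier = {p. \<forall>m \<in> Poly_Mapping.keys p. Poly_Mapping.keys m \<subseteq> gens n},
          mult = (*), one = 1, zero = 0, add = (+)\<rparr>"

definition gen :: "var \<Rightarrow> zpoly" where
  "gen v = Poly_Mapping.single (Poly_Mapping.single v 1) 1"

definition x :: "nat \<Rightarrow> zpoly" where
  "x i = gen (X i)"

definition q :: "nat \<Rightarrow> nat \<Rightarrow> nat \<Rightarrow> zpoly" where
  "q n i j = (if 1 \<le> i \<and> i < j \<and> j \<le> n then gen (Q i j) else 0)"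

text \<open>
  For \<open>j = i + 1\<close> and \<open>k = i\<close> the first two cases overlap; they agree because
  \<open>q n i i = 0 = q n (i + 1) (i + 1)\<close>. Maps on \<open>R n\<close> are made unique as HOL functions by
  requiring them to be \<^const>\<open>undefined\<close> outside the carrier.
\<close>

definition is_s :: "nat \<Rightarrow> nat \<Rightarrow> (zpoly \<Rightarrow> zpoly) \<Rightarrow> bool" where
  "is_s n k f \<longleftrightarrow>
     f \<in> ring_hom (R n) (R n) \<and> f \<in> extensional (carrier (R n)) \<and>
     f (x k) = x (k + 1) \<and> f (x (k + 1)) = x k \<and>
     (\<forall>i \<in> {1..n}. i \<noteq> k \<and> i \<noteq> k + 1 \<longrightarrow> f (x i) = x i) \<and>
     (\<forall>i j. 1 \<le> i \<and> i < j \<and> j \<le> n \<longrightarrow>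
        f (q n i j) =
          (if k = j - 1 then q n i j - q n i (j - 1) * (x (j - 1) - x j)
           else if k = i then q n i j + q n (i + 1) j * (x i - x (i + 1))
           else q n i j))"

definition s :: "nat \<Rightarrow> nat \<Rightarrow> zpoly \<Rightarrow> zpoly" where
  "s n k = (THE f. is_s n k f)"


subsection \<open>Existence and uniqueness of \<open>s\<close>\<close>

text \<open>Evaluation of a polynomial at \<open>\<sigma>\<close>.\<close>

definition mon_ev :: "(var \<Rightarrow> zpoly) \<Rightarrow> (var \<Rightarrow>\<^sub>0 nat) \<Rightarrow> zpoly" where
  "mon_ev \<sigma> m = (\<Prod>v \<in> Poly_Mapping.keys m. \<sigma> v ^ Poly_Mapping.lookup m v)"

definition ev :: "(var \<Rightarrow> zpoly) \<Rightarrow> zpoly \<Rightarrow> zpoly" where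
  "ev \<sigma> p = (\<Sum>m \<in> Poly_Mapping.keys p. of_int (Poly_Mapping.lookup p m) * mon_ev \<sigma> m)"

lemma of_int_eq_single: "(of_int a :: zpoly) = Poly_Mapping.single 0 a"
  by (simp flip: single_of_int)

lemma mon_ev_superset:
  assumes "finite A" "Poly_Mapping.keys m \<subseteq> A"
  shows "mon_ev \<sigma> m = (\<Prod>v \<in> A. \<sigma> v ^ Poly_Mapping.lookup m v)"
  unfolding mon_ev_def using assms
  by (intro prod.mono_neutral_left) (auto simp: in_keys_iff)

lemma mon_ev_add: "mon_ev \<sigma> (m + m') = mon_ev \<sigma> m * mon_ev \<sigma> m'"
proof -
  let ?A = "Poly_Mapping.keys m \<union> Poly_Mapping.keys m'"
  have "Poly_Mapping.keys (m + m') \<subseteq> ?A"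
    by (rule Poly_Mapping.keys_add)
  then show ?thesis
    by (simp add: mon_ev_superset[of ?A] lookup_add power_add prod.distrib)
qed

lemma ev_superset:
  assumes "finite A" "Poly_Mapping.keys p \<subseteq> A"
  shows "ev \<sigma> p = (\<Sum>m \<in> A. of_int (Poly_Mapping.lookup p m) * mon_ev \<sigma> m)"
  unfolding ev_def using assms
  by (intro sum.mono_neutral_left) (auto simp: in_keys_iff)

lemma ev_add: "ev \<sigma> (p + p') = ev \<sigma> p + ev \<sigma> p'"
proof -
  let ?A = "Poly_Mapping.keys p \<union> Poly_Mapping.keys p'"
  have "Poly_Mapping.keys (p + p') \<subseteq> ?A"
    by (rule Poly_Mapping.keys_add)
  then show ?thesis
    by (simp add: ev_superset[of ?A] lookup_add distrib_right sum.distrib)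
qed

lemma ev_zero: "ev \<sigma> 0 = 0"
  by (simp add: ev_def)

lemma ev_single: "ev \<sigma> (Poly_Mapping.single m a) = of_int a * mon_ev \<sigma> m"
  by (simp add: ev_superset[of "{m}"])

lemma ev_one: "ev \<sigma> 1 = 1"
  using ev_single[of \<sigma> 0 1] by (simp add: mon_ev_def)

lemma ev_gen: "ev \<sigma> (gen v) = \<sigma> v"
  by (simp add: gen_def ev_single mon_ev_superset[of "{v}"])

lemma ev_sum: "ev \<sigma> (sum f A) = (\<Sum>a \<in> A. ev \<sigma> (f a))"
  by (induction A rule: infinite_finite_induct) (simp_all add: ev_zero ev_add)

lemma sum_singles:
  "(\<Sum>m \<in> Poly_Mapping.keys p. Poly_Mapping.single m (Poly_Mapping.lookup p m)) = p"
  by (rule poly_mapping_eqI)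
     (simp add: lookup_sum lookup_single when_def in_keys_iff)

lemma ev_mult: "ev \<sigma> (p * p') = ev \<sigma> p * ev \<sigma> p'"
proof -
  let ?K = "Poly_Mapping.keys" and ?l = "Poly_Mapping.lookup"
  have "ev \<sigma> (p * p') =
    ev \<sigma> (\<Sum>m \<in> ?K p. \<Sum>m' \<in> ?K p'.
      Poly_Mapping.single m (?l p m) * Poly_Mapping.single m' (?l p' m'))"
    by (simp only: sum_product[symmetric] sum_singles)
  also have "\<dots> = (\<Sum>m \<in> ?K p. \<Sum>m' \<in> ?K p'.
      (of_int (?l p m) * mon_ev \<sigma> m) * (of_int (?l p' m') * mon_ev \<sigma> m'))"
    by (simp add: ev_sum mult_single ev_single mon_ev_add mult_ac)
  also have "\<dots> = ev \<sigma> p * ev \<sigma> p'"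
    by (simp only: sum_product[symmetric] ev_def)
  finally show ?thesis .
qed

lemma gen_power: "gen v ^ e = Poly_Mapping.single (Poly_Mapping.single v e) 1"
  by (induction e) (simp_all add: gen_def mult_single flip: single_add)

lemma prod_single:
  "(\<Prod>v \<in> A. Poly_Mapping.single (g v) (1::int)) = Poly_Mapping.single (\<Sum>v \<in> A. g v :: var \<Rightarrow>\<^sub>0 nat) 1"
  by (induction A rule: infinite_finite_induct) (simp_all add: mult_single)

lemma mon_ev_gen: "mon_ev gen m = Poly_Mapping.single m 1"
proof -
  have "(\<Sum>v \<in> Poly_Mapping.keys m. Poly_Mapping.single v (Poly_Mapping.lookup m v)) = m"
    by (rule poly_mapping_eqI) (simp add: lookup_sum lookup_single when_def in_keys_iff)
  then show ?thesis
    by (simp add: mon_ev_def gen_power prod_single)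
qed

lemma ev_gen_id: "ev gen p = p"
proof -
  have "of_int a * Poly_Mapping.single m 1 = Poly_Mapping.single m (a::int)"
    for a and m :: "var \<Rightarrow>\<^sub>0 nat"
    using mult_single[of 0 a m 1] by (simp add: of_int_eq_single)
  then show ?thesis
    by (simp add: ev_def mon_ev_gen sum_singles)
qed

lemma R_simps [simp]:
  "mult (R n) = (*)" "one (R n) = 1" "zero (R n) = 0" "add (R n) = (+)"
  by (simp_all add: R_def)

lemma in_R_iff:
  "p \<in> carrier (R n) \<longleftrightarrow> (\<forall>m \<in> Poly_Mapping.keys p. Poly_Mapping.keys m \<subseteq> gens n)"
  by (simp add: R_def)

lemma R_add: "p \<in> carrier (R n) \<Longrightarrow> p' \<in> carrier (R n) \<Longrightarrow> p + p' \<in> carrier (R n)"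
  using Poly_Mapping.keys_add[of p p'] unfolding in_R_iff by blast

lemma R_uminus: "p \<in> carrier (R n) \<Longrightarrow> - p \<in> carrier (R n)"
  unfolding in_R_iff by (simp add: in_keys_iff)

lemma R_diff: "p \<in> carrier (R n) \<Longrightarrow> p' \<in> carrier (R n) \<Longrightarrow> p - p' \<in> carrier (R n)"
  using R_add[of p n "- p'"] R_uminus[of p' n] by simp

lemma R_mult:
  assumes "p \<in> carrier (R n)" "p' \<in> carrier (R n)"
  shows "p * p' \<in> carrier (R n)"
  unfolding in_R_iff
proof
  fix m assume "m \<in> Poly_Mapping.keys (p * p')"
  then obtain a b where "m = a + b" "a \<in> Poly_Mapping.keys p" "b \<in> Poly_Mapping.keys p'"
    using keys_mult[of p p'] by blast
  then show "Poly_Mapping.keys m \<subseteq> gens n"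
    using assms Poly_Mapping.keys_add[of a b] unfolding in_R_iff by blast
qed

lemma R_zero: "0 \<in> carrier (R n)"
  by (simp add: in_R_iff)

lemma R_one: "1 \<in> carrier (R n)"
  by (simp add: in_R_iff)

lemma R_of_int: "of_int a \<in> carrier (R n)"
  by (simp add: in_R_iff of_int_eq_single)

lemma R_power: "p \<in> carrier (R n) \<Longrightarrow> p ^ e \<in> carrier (R n)"
  by (induction e) (auto intro: R_one R_mult)

lemma R_prod: "(\<And>a. a \<in> A \<Longrightarrow> f a \<in> carrier (R n)) \<Longrightarrow> prod f A \<in> carrier (R n)"
  by (induction A rule: infinite_finite_induct) (auto intro: R_one R_mult)

lemma R_sum: "(\<And>a. a \<in> A \<Longrightarrow> f a \<in> carrier (R n)) \<Longrightarrow> sum f A \<in> carrier (R n)"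
  by (induction A rule: infinite_finite_induct) (auto intro: R_zero R_add)

lemma gen_in_R: "v \<in> gens n \<Longrightarrow> gen v \<in> carrier (R n)"
  by (simp add: in_R_iff gen_def)

lemma x_in_R: "1 \<le> i \<Longrightarrow> i \<le> n \<Longrightarrow> x i \<in> carrier (R n)"
  by (auto simp: x_def gens_def intro!: gen_in_R)

lemma q_in_R: "q n i j \<in> carrier (R n)"
  by (auto simp: q_def gens_def R_zero intro!: gen_in_R)

lemma cring_R: "cring (R n)"
proof (rule cringI)
  show "abelian_group (R n)"
    by (rule abelian_groupI)
       (auto simp: add_ac intro: R_add R_zero intro!: bexI[OF _ R_uminus])
  show "comm_monoid (R n)"
    by (rule comm_monoidI) (auto simp: mult_ac intro: R_mult R_one)
qed (simp add: distrib_right)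

lemma ev_in_R:
  assumes "\<And>v. v \<in> gens n \<Longrightarrow> \<sigma> v \<in> carrier (R n)" "p \<in> carrier (R n)"
  shows "ev \<sigma> p \<in> carrier (R n)"
proof -
  have "mon_ev \<sigma> m \<in> carrier (R n)" if "m \<in> Poly_Mapping.keys p" for m
    unfolding mon_ev_def using assms that unfolding in_R_iff[of p]
    by (intro R_prod R_power) blast
  then show ?thesis
    unfolding ev_def by (intro R_sum R_mult R_of_int)
qed

lemma hom_eq_ev:
  assumes f: "f \<in> ring_hom (R n) (R n)" and p: "p \<in> carrier (R n)"
    and \<sigma>: "\<And>v. v \<in> gens n \<Longrightarrow> f (gen v) = \<sigma> v"
  shows "f p = ev \<sigma> p"
proof -
  have add: "f (a + b) = f a + f b" and mult: "f (a * b) = f a * f b"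
    if "a \<in> carrier (R n)" "b \<in> carrier (R n)" for a b
    using ring_hom_add[OF f that] ring_hom_mult[OF f that] by simp_all
  have one: "f 1 = 1"
    using ring_hom_one[OF f] by simp
  have zero: "f 0 = 0"
    using add[OF R_zero R_zero] by simp
  have uminus: "f (- a) = - f a" if "a \<in> carrier (R n)" for a
    using add[OF that R_uminus[OF that]] zero by (simp add: eq_neg_iff_add_eq_0 add.commute)
  have of_nat: "f (of_nat a) = of_nat a" for a
  proof (induction a)
    case (Suc a)
    then show ?case
      using add[OF R_one R_of_int[of "int a"]] one by simp
  qed (simp add: zero)
  have of_int: "f (of_int a) = of_int a" for a
  proof (cases a rule: int_cases2)
    case (nonneg m)
    then show ?thesis
      using of_nat[of m] by simp
  next
    case (nonpos m)
    then show ?thesis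
      using uminus[OF R_of_int[of "int m"]] of_nat[of m] by simp
  qed
  have power: "f (a ^ e) = f a ^ e" if "a \<in> carrier (R n)" for a e
    by (induction e) (simp_all add: one mult that R_power)
  have prod: "f (prod g A) = (\<Prod>a \<in> A. f (g a))"
    if "\<And>a. a \<in> A \<Longrightarrow> g a \<in> carrier (R n)" for g and A :: "var set"
    using that
    by (induction A rule: infinite_finite_induct) (simp_all add: one mult R_prod)
  have sum: "f (sum g A) = (\<Sum>a \<in> A. f (g a))"
    if "\<And>a. a \<in> A \<Longrightarrow> g a \<in> carrier (R n)" for g and A :: "(var \<Rightarrow>\<^sub>0 nat) set"
    using that
    by (induction A rule: infinite_finite_induct) (simp_all add: zero add R_sum)
  have gens: "v \<in> gens n"
    if "m \<in> Poly_Mapping.keys p" "v \<in> Poly_Mapping.keys m" for m v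
    using p that unfolding in_R_iff by blast
  have mon_R: "mon_ev gen m \<in> carrier (R n)" if "m \<in> Poly_Mapping.keys p" for m
    unfolding mon_ev_def using gens[OF that] by (intro R_prod R_power gen_in_R)
  have mon: "f (mon_ev gen m) = mon_ev \<sigma> m" if "m \<in> Poly_Mapping.keys p" for m
    unfolding mon_ev_def using gens[OF that]
    by (simp add: prod power R_power gen_in_R \<sigma>)
  have "f p = f (ev gen p)"
    by (simp add: ev_gen_id)
  also have "\<dots> = ev \<sigma> p"
    unfolding ev_def by (simp add: sum mult R_mult R_of_int mon_R mon of_int)
  finally show ?thesis .
qed

fun s_image :: "nat \<Rightarrow> nat \<Rightarrow> var \<Rightarrow> zpoly" where
  "s_image n k (X i) = (if i = k then x (k + 1) else if i = k + 1 then x k else x i)"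
| "s_image n k (Q i j) =
     (if k = j - 1 then q n i j - q n i (j - 1) * (x (j - 1) - x j)
      else if k = i then q n i j + q n (i + 1) j * (x i - x (i + 1))
      else q n i j)"

lemma s_image_in_R:
  assumes "k \<in> {1..n - 1}" "v \<in> gens n"
  shows "s_image n k v \<in> carrier (R n)"
  using assms
  by (cases v) (auto simp: gens_def intro!: R_add R_diff R_mult q_in_R x_in_R)

lemma is_s_iff:
  assumes k: "k \<in> {1..n - 1}"
  shows "is_s n k f \<longleftrightarrow> f = restrict (ev (s_image n k)) (carrier (R n))"
proof
  assume f: "is_s n k f"
  have val: "f (gen v) = s_image n k v" if "v \<in> gens n" for v
  proof (cases v)
    case (X i)
    then have "i \<in> {1..n}"
      using that by (auto simp: gens_def)
    then show ?thesis
      using f X unfolding is_s_def x_def[symmetric] by (auto simp: x_def[symmetric])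
  next
    case (Q i j)
    then have *: "1 \<le> i \<and> i < j \<and> j \<le> n"
      using that by (auto simp: gens_def)
    then have "gen v = q n i j"
      using Q by (simp add: q_def)
    then show ?thesis
      using f * unfolding is_s_def Q s_image.simps by metis
  qed
  show "f = restrict (ev (s_image n k)) (carrier (R n))"
  proof (rule extensionalityI)
    show "f \<in> extensional (carrier (R n))"
      using f by (simp add: is_s_def)
    show "f p = restrict (ev (s_image n k)) (carrier (R n)) p" if "p \<in> carrier (R n)" for p
      using hom_eq_ev[of f n p "s_image n k"] val f that by (simp add: is_s_def)
  qed simp
next
  let ?f = "restrict (ev (s_image n k)) (carrier (R n))"
  assume f: "f = ?f"
  have "?f \<in> ring_hom (R n) (R n)"
    by (rule ring_hom_memI)
       (simp_all add: ev_in_R[OF s_image_in_R[OF k]] R_mult R_add R_one ev_mult ev_add ev_one)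
  moreover have x: "?f (x i) = s_image n k (X i)" if "1 \<le> i" "i \<le> n" for i
    using x_in_R[OF that] by (simp add: x_def ev_gen del: s_image.simps)
  moreover have "?f (q n i j) = s_image n k (Q i j)" if "1 \<le> i \<and> i < j \<and> j \<le> n" for i j
    using q_in_R[of n i j] that by (simp add: q_def ev_gen del: s_image.simps)
  moreover have "1 \<le> k" "k + 1 \<le> n"
    using k by auto
  ultimately show "is_s n k f"
    unfolding is_s_def f by (auto simp del: restrict_apply)
qed

theorem ex1_is_s: "k \<in> {1..n - 1} \<Longrightarrow> \<exists>!f. is_s n k f"
  by (simp add: is_s_iff)

theorem is_s_s: "k \<in> {1..n - 1} \<Longrightarrow> is_s n k (s n k)"
  unfolding s_def by (rule theI'[OF ex1_is_s])

end

theory Submission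
  imports Defs
begin

text \<open>
  Each \<open>s n k\<close> is the restriction of the substitution \<open>ev (s_image n k)\<close>, which is a ring
  endomorphism of all of \<^typ>\<open>zpoly\<close>. With \<open>q n i j = 0\<close> outside the admissible range, the
  action on \<open>q n i j\<close> is given by one formula valid for all indices, and the relations become
  polynomial identities, checked according to which of \<open>i\<close> and \<open>j\<close> are moved.
\<close>

lemma ev_diff: "ev \<sigma> (p - p') = ev \<sigma> p - ev \<sigma> p'"
  using ev_add[of \<sigma> "p - p'" p'] by (simp add: algebra_simps)

lemma s_eq_ev:
  assumes "k \<in> {1..n - 1}" "p \<in> carrier (R n)"
  shows "s n k p = ev (s_image n k) p"
  using is_s_s[OF assms(1)] assms by (simp add: is_s_iff)

text \<open>\<open>s n k\<close> is \<open>undefined\<close> off the carrier, so unfolding an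
  iterate with \<open>s_eq_ev\<close> needs each inner value to lie in \<open>R n\<close>.\<close>

lemma s_in_R: "k \<in> {1..n - 1} \<Longrightarrow> p \<in> carrier (R n) \<Longrightarrow> s n k p \<in> carrier (R n)"
  by (simp add: s_eq_ev ev_in_R s_image_in_R)

lemma ev_s_image_x:
  "ev (s_image n k) (x i) = (if i = k then x (Suc k) else if i = Suc k then x k else x i)"
  by (simp add: x_def ev_gen)

lemma q_eq_0: "j \<le> i \<Longrightarrow> q n i j = 0"
  by (simp add: q_def)

text \<open>If \<open>i = k\<close> and \<open>j = Suc k\<close>, both corrections vanish with
  \<open>q n k k\<close> and \<open>q n (Suc k) (Suc k)\<close>. Outside the admissible range every
  term is zero, because \<open>1 \<le> k\<close> and \<open>k < n\<close>.\<close>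

lemma ev_s_image_q:
  assumes "k \<in> {1..n - 1}"
  shows "ev (s_image n k) (q n i j) =
    q n i j - (if j = Suc k then q n i k * (x k - x (Suc k)) else 0)
            + (if i = k then q n (Suc k) j * (x k - x (Suc k)) else 0)"
proof (cases "1 \<le> i \<and> i < j \<and> j \<le> n")
  case True
  then have "ev (s_image n k) (q n i j) = s_image n k (Q i j)"
    by (simp add: q_def ev_gen)
  moreover have "k = j - 1 \<longleftrightarrow> j = Suc k"
    using True by auto
  ultimately show ?thesis
    by (auto simp: q_eq_0)
next
  case False
  then show ?thesis
    using assms by (auto simp: q_def ev_zero)
qed

lemmas ev_s_image_simps = ev_add ev_diff ev_mult ev_zero ev_s_image_x ev_s_image_q

theorem lemma9p2:
  fixes n i j :: nat
  assumes "n \<ge> 1" and "1 \<le> i" and "i < j" and "j \<le> n"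
  shows "(\<forall>k \<in> {1..n - 1}. (s n k ^^ 2) (q n i j) = q n i j) \<and>
         (\<forall>k \<in> {1..n - 1}. \<forall>l \<in> {1..n - 1}. \<bar>int k - int l\<bar> > 1 \<longrightarrow>
            (s n k \<circ> s n l) (q n i j) = (s n l \<circ> s n k) (q n i j)) \<and>
         (\<forall>k \<in> {1..n - 1}. k + 1 \<le> n - 1 \<longrightarrow>
            (s n k \<circ> s n (k + 1) \<circ> s n k) (q n i j) =
            (s n (k + 1) \<circ> s n k \<circ> s n (k + 1)) (q n i j))"
proof (intro conjI ballI impI)
  fix k assume k: "k \<in> {1..n - 1}"
  \<comment> \<open>The factor \<open>x k - x (Suc k)\<close> changes sign while its coefficient is
    fixed, so the second correction cancels the first.\<close>
  have "ev (s_image n k) (ev (s_image n k) (q n i j)) = q n i j"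
    using k by (simp add: ev_s_image_simps q_eq_0 algebra_simps)
  then show "(s n k ^^ 2) (q n i j) = q n i j"
    using k s_in_R[OF k q_in_R] by (simp add: numeral_2_eq_2 s_eq_ev q_in_R)
next
  fix k l assume k: "k \<in> {1..n - 1}" and l: "l \<in> {1..n - 1}" and "\<bar>int k - int l\<bar> > 1"
  \<comment> \<open>Non-adjacency makes each map fix the difference of variables in the other's
    correction; if both ends of \<open>q n i j\<close> move, the corrections are
    independent.\<close>
  then have "k \<noteq> l" "k \<noteq> Suc l" "l \<noteq> Suc k"
    by auto
  then have "ev (s_image n k) (ev (s_image n l) (q n i j)) =
      ev (s_image n l) (ev (s_image n k) (q n i j))"
    using k l by (simp add: ev_s_image_simps algebra_simps)
  then show "(s n k \<circ> s n l) (q n i j) = (s n l \<circ> s n k) (q n i j)"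
    using k l s_in_R[OF k q_in_R] s_in_R[OF l q_in_R] by (simp add: s_eq_ev q_in_R)
next
  fix k assume k: "k \<in> {1..n - 1}" and "k + 1 \<le> n - 1"
  then have l: "Suc k \<in> {1..n - 1}"
    by simp
  \<comment> \<open>Both sides expand by cases on \<open>i\<close> and \<open>j\<close>;
    \<open>q_eq_0\<close> removes the terms in which shifted indices meet or cross.\<close>
  have "ev (s_image n k) (ev (s_image n (Suc k)) (ev (s_image n k) (q n i j))) =
      ev (s_image n (Suc k)) (ev (s_image n k) (ev (s_image n (Suc k)) (q n i j)))"
    using k l by (simp add: ev_s_image_simps q_eq_0 algebra_simps)
  then show "(s n k \<circ> s n (k + 1) \<circ> s n k) (q n i j) =
      (s n (k + 1) \<circ> s n k \<circ> s n (k + 1)) (q n i j)"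
    using k l s_in_R[OF k s_in_R[OF l q_in_R]] s_in_R[OF l s_in_R[OF k q_in_R]]
      s_in_R[OF k q_in_R] s_in_R[OF l q_in_R] by (simp add: s_eq_ev q_in_R s_in_R)
qed

end
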